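(* Let $\mu$ be a finite Borel measure on $\mathbb{R}^d$ with closed support $K_\mu$, let $\Lambda\subset\mathbb{R}^d$ be countable and let $\varphi:K_\mu\to\mathbb{R}^d$ be Borel measurable. Let $\nu=\varphi_*\mu$ be the pushforward Borel measure on $\mathbb{R}^d$. Then: (1) The collection $E(\Lambda,\varphi)=\{e^{2\pi i\lambda\cdot\varphi(x)}:\lambda\in\Lambda\}$ is an orthogonal basis for $L^2(\mu)$ if and only if $\varphi$ is $\mu$-essentially injective and $\nu$ is a spectral measure with spectrum $\Lambda$. (2) The collection $E(\Lambda,\varphi)$ forms a frame for $L^2(\mu)$ if and only if $\varphi$ is $\mu$-essentially injective and $\nu$ is a frame-spectral measure with frame spectrum $\Lambda$.
   Context: The pushforward is $\varphi_*\mu(E)=\mu(\varphi^{-1}(E))$ for Borel $E\subset\mathbb{R}^d$. The function $\varphi$ is $\mu$-essentially injective if for every $f\in L^2(\mu)$ there is $h\in L^2(\varphi_*\mu)$ with $f(x)=h(\varphi(x))$ for $\mu$-a.e. $x$. Write $E(\Lambda)=\{e^{2\pi i\lambda\cdot x}:\lambda\in\Lambda\}$; all collections are indexed by $\Lambda$. A finite Borel measure $\nu$ is a spectral measure with spectrum $\Lambda$ (a countable discrete set) if $E(\Lambda)$ is an orthogonal basis for $L^2(\nu)$. It is a frame-spectral measure with frame spectrum $\Lambda$ if $E(\Lambda)$ is a frame for $L^2(\nu)$. A countable family $\{x_n\}$ in a Hilbert space $\mathcal{H}$ is a frame if there are constants $0<A\le B<\infty$ with $A\|x\|^2\le\sum_n|\langle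 x,x_n\rangle|^2\le B\|x\|^2$ for all $x\in\mathcal{H}$. *)

theory Defs
  imports "HOL-Analysis.Analysis"
begin

section \<open>The space $L^2(M)$ of complex-valued functions\<close>

text \<open>
  Elements of $L^2(M)$ are handled through representatives: \<open>L2_space M\<close> is the set of
  square-integrable functions, and two of them represent the same vector iff they agree
  \<open>M\<close>-almost everywhere, i.e. iff the \<open>L2_norm\<close> of their difference is 0. So \<open>L2_norm\<close> is
  only a seminorm on functions, and a vector \<open>f\<close> is nonzero iff \<open>L2_norm M f \<noteq> 0\<close>.
\<close>

definition L2_space :: "'a measure \<Rightarrow> ('a \<Rightarrow> complex) set" where
  "L2_space M = {f \<in> borel_measurable M. integrable M (\<lambda>x. (cmod (f x))\<^sup>2)}"

definition L2_inner :: "'a measure \<Rightarrow> ('a \<Rightarrow> complex) \<Rightarrow> ('a \<Rightarrow> complex) \<Rightarrow> complex" where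
  "L2_inner M f g = (LINT x|M. f x * cnj (g x))"

definition L2_norm :: "'a measure \<Rightarrow> ('a \<Rightarrow> complex) \<Rightarrow> real" where
  "L2_norm M f = sqrt (LINT x|M. (cmod (f x))\<^sup>2)"

section \<open>Indexed orthogonal bases and frames\<close>

text \<open>
  An orthogonal basis is a family of nonzero, pairwise orthogonal vectors whose finite linear
  combinations are dense. Orthogonality concerns distinct indices, so an orthogonal basis
  cannot repeat a vector.
\<close>

definition L2_orthogonal_basis :: "'a measure \<Rightarrow> 'i set \<Rightarrow> ('i \<Rightarrow> 'a \<Rightarrow> complex) \<Rightarrow> bool" where
  "L2_orthogonal_basis M I e \<longleftrightarrow>
     (\<forall>i\<in>I. e i \<in> L2_space M \<and> L2_norm M (e i) \<noteq> 0) \<and>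
     (\<forall>i\<in>I. \<forall>j\<in>I. i \<noteq> j \<longrightarrow> L2_inner M (e i) (e j) = 0) \<and>
     (\<forall>f\<in>L2_space M. \<forall>\<epsilon>>0. \<exists>F c. finite F \<and> F \<subseteq> I \<and>
        L2_norm M (\<lambda>x. f x - (\<Sum>i\<in>F. c i * e i x)) < \<epsilon>)"

text \<open>
  Summability is required explicitly, since \<open>infsum\<close> is 0 on families that are not summable.
\<close>

definition L2_frame :: "'a measure \<Rightarrow> 'i set \<Rightarrow> ('i \<Rightarrow> 'a \<Rightarrow> complex) \<Rightarrow> bool" where
  "L2_frame M I e \<longleftrightarrow>
     countable I \<and>
     (\<forall>i\<in>I. e i \<in> L2_space M) \<and>
     (\<exists>A B :: real. 0 < A \<and> A \<le> B \<and>
        (\<forall>f\<in>L2_space M.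
           (\<lambda>i. (cmod (L2_inner M f (e i)))\<^sup>2) summable_on I \<and>
           A * (L2_norm M f)\<^sup>2 \<le> (\<Sum>\<^sub>\<infinity>i\<in>I. (cmod (L2_inner M f (e i)))\<^sup>2) \<and>
           (\<Sum>\<^sub>\<infinity>i\<in>I. (cmod (L2_inner M f (e i)))\<^sup>2) \<le> B * (L2_norm M f)\<^sup>2))"

section \<open>Spectral and frame-spectral measures\<close>

definition expo :: "'a::euclidean_space \<Rightarrow> 'a \<Rightarrow> complex" where
  "expo \<xi> x = exp (2 * of_real pi * \<i> * of_real (\<xi> \<bullet> x))"

definition finite_borel_measure :: "'a::topological_space measure \<Rightarrow> bool" where
  "finite_borel_measure M \<longleftrightarrow> finite_measure M \<and> sets M = sets borel"

definition spectral_measure :: "'a::euclidean_space measure \<Rightarrow> 'a set \<Rightarrow> bool" where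
  "spectral_measure \<nu> \<Lambda> \<longleftrightarrow>
     finite_borel_measure \<nu> \<and> countable \<Lambda> \<and> discrete \<Lambda> \<and> L2_orthogonal_basis \<nu> \<Lambda> expo"

definition frame_spectral_measure :: "'a::euclidean_space measure \<Rightarrow> 'a set \<Rightarrow> bool" where
  "frame_spectral_measure \<nu> \<Lambda> \<longleftrightarrow> finite_borel_measure \<nu> \<and> L2_frame \<nu> \<Lambda> expo"

section \<open>Functions on the closed support\<close>

definition closed_support :: "'a::topological_space measure \<Rightarrow> 'a set" where
  "closed_support M = {x. \<forall>U. open U \<and> x \<in> U \<longrightarrow> emeasure M U > 0}"

text \<open>
  A function on the closed support \<open>K\<close> of \<open>\<mu>\<close> is encoded as a total function \<open>\<phi>\<close> whose values
  outside \<open>K\<close> are irrelevant: only its restriction to \<open>K\<close> is assumed to be measurable, and the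
  pushforward only involves the points of \<open>K\<close>.
\<close>

definition pushforward ::
    "'a::euclidean_space measure \<Rightarrow> ('a \<Rightarrow> 'b::euclidean_space) \<Rightarrow> 'b measure" where
  "pushforward \<mu> \<phi> = distr (restrict_space \<mu> (closed_support \<mu>)) borel \<phi>"

definition essentially_injective ::
    "'a::euclidean_space measure \<Rightarrow> ('a \<Rightarrow> 'b::euclidean_space) \<Rightarrow> bool" where
  "essentially_injective \<mu> \<phi> \<longleftrightarrow>
     (\<forall>f\<in>L2_space \<mu>. \<exists>h\<in>L2_space (pushforward \<mu> \<phi>). AE x in \<mu>. f x = h (\<phi> x))"

text \<open>
  The function \<open>x \<mapsto> exp (2 \<pi> \<i> (\<xi> \<bullet> \<phi> x))\<close> on \<open>K\<close>, as an element of $L^2(\mu)$: it is extended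
  by 0 to the complement of \<open>K\<close>, which is a null set of \<open>\<mu>\<close>.
\<close>

definition expo_comp ::
    "'a::euclidean_space measure \<Rightarrow> ('a \<Rightarrow> 'b::euclidean_space) \<Rightarrow> 'b \<Rightarrow> 'a \<Rightarrow> complex" where
  "expo_comp \<mu> \<phi> \<xi> x = (if x \<in> closed_support \<mu> then expo \<xi> (\<phi> x) else 0)"

lemma closed_closed_support: "closed (closed_support M)"
proof -
  have "- closed_support M = \<Union> {U. open U \<and> emeasure M U = 0}"
    by (auto simp: closed_support_def zero_less_iff_neq_zero)
  then show ?thesis
    by (metis (no_types, lifting) closed_def mem_Collect_eq open_Union)
qed

lemma emeasure_compl_closed_support:
  fixes M :: "'a::euclidean_space measure"
  assumes "sets M = sets borel"
  shows "emeasure M (- closed_support M) = 0"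
proof -
  obtain \<B> :: "'a set set" where \<B>: "countable \<B>" "topological_basis \<B>"
    using ex_countable_basis by blast
  have eq: "- closed_support M = \<Union> {U \<in> \<B>. emeasure M U = 0}" (is "_ = ?R")
  proof (intro equalityI subsetI)
    fix x assume "x \<in> - closed_support M"
    then obtain U where U: "open U" "x \<in> U" "emeasure M U = 0"
      by (auto simp: closed_support_def zero_less_iff_neq_zero)
    then obtain V where V: "V \<in> \<B>" "x \<in> V" "V \<subseteq> U"
      using \<B>(2) topological_basisE by blast
    have "emeasure M V \<le> emeasure M U"
      using U V assms by (intro emeasure_mono) auto
    with U V show "x \<in> ?R" by auto
  next
    fix x assume "x \<in> ?R"
    then show "x \<in> - closed_support M"
      using topological_basis_open[OF \<B>(2)]
      by (auto simp: closed_support_def zero_less_iff_neq_zero)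
  qed
  have "(\<Union>U \<in> {U \<in> \<B>. emeasure M U = 0}. U) \<in> null_sets M"
    using \<B> assms topological_basis_open[OF \<B>(2)]
    by (intro null_sets_UN') (auto intro!: null_setsI)
  then show ?thesis
    by (simp add: eq null_setsD1)
qed

lemma emeasure_pushforward:
  assumes "sets \<mu> = sets borel"
    and "\<phi> \<in> borel_measurable (restrict_space borel (closed_support \<mu>))"
    and "E \<in> sets borel"
  shows "emeasure (pushforward \<mu> \<phi>) E = emeasure \<mu> {x \<in> closed_support \<mu>. \<phi> x \<in> E}"
proof -
  have "space \<mu> = UNIV"
    using sets_eq_imp_space_eq[OF assms(1)] by simp
  moreover have K: "closed_support \<mu> \<in> sets \<mu>"
    by (simp add: assms(1) borel_closed closed_closed_support)
  moreover have "sets (restrict_space \<mu> (closed_support \<mu>))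
      = sets (restrict_space borel (closed_support \<mu>))"
    by (intro sets_restrict_space_cong assms)
  then have "\<phi> \<in> borel_measurable (restrict_space \<mu> (closed_support \<mu>))"
    using assms(2) measurable_cong_sets by blast
  ultimately show ?thesis
    using assms(3)
    by (simp add: pushforward_def emeasure_distr space_restrict_space emeasure_restrict_space
        vimage_def Int_def conj_commute)
qed

end

theory Submission
  imports Defs
begin

text \<open>
  Write \<open>\<nu>\<close> for the pushforward. By the change of variables formula \<open>h \<mapsto> h \<circ> \<phi>\<close> is an isometric
  embedding of $L^2(\nu)$ into $L^2(\mu)$, it sends the exponentials on the target to
  \<open>E(\<Lambda>, \<phi>)\<close>, and essential injectivity says precisely that it is onto. An onto isometry carries
  orthogonal bases and frames back and forth. Even without surjectivity the two properties descend
  from $L^2(\mu)$ to $L^2(\nu)$, because they only have to be tested on the image of the embedding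
  (\<open>orthogonal_basis_of_pullback\<close>, \<open>frame_of_pullback\<close>).

  What remains is that the embedding is onto as soon as \<open>E(\<Lambda>, \<phi>)\<close> is a basis or a frame, and in
  both cases this follows from the triviality of the orthogonal complement of \<open>E(\<Lambda>, \<phi>)\<close>. For a
  function \<open>f\<close> with values in the unit interval, the conditional expectation of \<open>f\<close> given \<open>\<phi>\<close> is a
  bounded function of \<open>\<phi>\<close> whose difference from \<open>f\<close> is orthogonal to \<open>E(\<Lambda>, \<phi>)\<close>; so \<open>f\<close> itself is
  a function of \<open>\<phi>\<close> almost everywhere (\<open>total_imp_bounded_factors\<close>). Applied to squashed
  coordinates, this gives a measurable \<open>H\<close> with \<open>H (\<phi> x) = x\<close> for almost every \<open>x\<close>
  (\<open>total_imp_left_inverse\<close>), whence \<open>f = (f \<circ> H) \<circ> \<phi>\<close> for every \<open>f\<close>. This route avoids both the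
  completeness of $L^2$ and any limit of linear combinations of exponentials.

  A spectrum must moreover be discrete. For an orthogonal family of exponentials this is automatic,
  since the inner product is continuous in the frequencies
  (\<open>orthogonal_expo_imp_discrete\<close>).
\<close>

section \<open>Square-integrable functions\<close>

lemma borel_measurable_cnj [measurable]:
  assumes [measurable]: "f \<in> borel_measurable M"
  shows "(\<lambda>x. cnj (f x)) \<in> borel_measurable M"
proof -
  have "cnj \<in> borel_measurable borel"
    by (intro borel_measurable_continuous_onI continuous_intros)
  then show ?thesis
    by (rule measurable_compose[OF assms])
qed

lemma L2_space_measurable: "f \<in> L2_space M \<Longrightarrow> f \<in> borel_measurable M"
  and L2_space_square_integrable: "f \<in> L2_space M \<Longrightarrow> integrable M (\<lambda>x. (cmod (f x))\<^sup>2)"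
  by (auto simp: L2_space_def)

lemma L2_norm_square: "(L2_norm M f)\<^sup>2 = (LINT x|M. (cmod (f x))\<^sup>2)"
  by (simp add: L2_norm_def)

lemma L2_space_product_integrable:
  assumes "f \<in> L2_space M" "g \<in> L2_space M"
  shows "integrable M (\<lambda>x. f x * cnj (g x))"
proof (rule Bochner_Integration.integrable_bound)
  note [measurable] = L2_space_measurable[OF assms(1)] L2_space_measurable[OF assms(2)]
  show "integrable M (\<lambda>x. (cmod (f x))\<^sup>2 + (cmod (g x))\<^sup>2)"
    using assms by (simp add: L2_space_square_integrable)
  show "(\<lambda>x. f x * cnj (g x)) \<in> borel_measurable M"
    by measurable
  show "AE x in M. cmod (f x * cnj (g x)) \<le> norm ((cmod (f x))\<^sup>2 + (cmod (g x))\<^sup>2)"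
  proof (intro AE_I2)
    fix x
    have "2 * (cmod (f x) * cmod (g x)) \<le> (cmod (f x))\<^sup>2 + (cmod (g x))\<^sup>2"
      using sum_squares_bound[of "cmod (f x)" "cmod (g x)"] by (simp add: mult.assoc)
    moreover have "0 \<le> cmod (f x) * cmod (g x)" by simp
    ultimately have "cmod (f x) * cmod (g x) \<le> (cmod (f x))\<^sup>2 + (cmod (g x))\<^sup>2"
      by linarith
    then show "cmod (f x * cnj (g x)) \<le> norm ((cmod (f x))\<^sup>2 + (cmod (g x))\<^sup>2)"
      by (simp add: norm_mult)
  qed
qed

lemma L2_space_add:
  assumes "f \<in> L2_space M" "g \<in> L2_space M"
  shows "(\<lambda>x. f x + g x) \<in> L2_space M"
proof -
  note [measurable] = L2_space_measurable[OF assms(1)] L2_space_measurable[OF assms(2)]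
  have "integrable M (\<lambda>x. (cmod (f x + g x))\<^sup>2)"
  proof (rule Bochner_Integration.integrable_bound)
    show "integrable M (\<lambda>x. 2 * (cmod (f x))\<^sup>2 + 2 * (cmod (g x))\<^sup>2)"
      using assms by (simp add: L2_space_square_integrable)
    show "AE x in M. norm ((cmod (f x + g x))\<^sup>2) \<le> norm (2 * (cmod (f x))\<^sup>2 + 2 * (cmod (g x))\<^sup>2)"
    proof (intro AE_I2)
      fix x
      have "(cmod (f x + g x))\<^sup>2 \<le> (cmod (f x) + cmod (g x))\<^sup>2"
        by (simp add: norm_triangle_ineq power_mono)
      also have "\<dots> \<le> 2 * (cmod (f x))\<^sup>2 + 2 * (cmod (g x))\<^sup>2"
        using sum_squares_bound[of "cmod (f x)" "cmod (g x)"] by (simp add: power2_sum)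
      finally show "norm ((cmod (f x + g x))\<^sup>2) \<le> norm (2 * (cmod (f x))\<^sup>2 + 2 * (cmod (g x))\<^sup>2)"
        by simp
    qed
  qed measurable
  then show ?thesis by (simp add: L2_space_def)
qed

lemma L2_space_cmult: "f \<in> L2_space M \<Longrightarrow> (\<lambda>x. c * f x) \<in> L2_space M"
  by (auto simp: L2_space_def norm_mult power_mult_distrib intro: borel_measurable_times)

lemma L2_space_diff:
  assumes "f \<in> L2_space M" "g \<in> L2_space M"
  shows "(\<lambda>x. f x - g x) \<in> L2_space M"
  using L2_space_add[OF assms(1) L2_space_cmult[OF assms(2), of "-1"]] by simp

lemma L2_space_sum:
  assumes "\<And>i. i \<in> F \<Longrightarrow> f i \<in> L2_space M"
  shows "(\<lambda>x. \<Sum>i\<in>F. f i x) \<in> L2_space M"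
  using assms
proof (induction F rule: infinite_finite_induct)
  case (insert i F)
  then show ?case by (simp add: L2_space_add)
qed (simp_all add: L2_space_def)

lemma L2_space_bounded:
  assumes "finite_measure M" and [measurable]: "f \<in> borel_measurable M"
    and "\<And>x. cmod (f x) \<le> C"
  shows "f \<in> L2_space M"
proof -
  interpret finite_measure M by fact
  have "integrable M (\<lambda>x. (cmod (f x))\<^sup>2)"
    by (rule integrable_const_bound[of _ "C\<^sup>2"]) (simp_all add: assms(3) power_mono)
  then show ?thesis by (simp add: L2_space_def)
qed

lemma L2_norm_eq_0_iff:
  assumes "f \<in> L2_space M"
  shows "L2_norm M f = 0 \<longleftrightarrow> (AE x in M. f x = 0)"
proof -
  have "L2_norm M f = 0 \<longleftrightarrow> (LINT x|M. (cmod (f x))\<^sup>2) = 0"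
    by (simp add: L2_norm_def)
  also have "\<dots> \<longleftrightarrow> (AE x in M. (cmod (f x))\<^sup>2 = 0)"
    by (rule integral_nonneg_eq_0_iff_AE) (simp_all add: L2_space_square_integrable[OF assms])
  finally show ?thesis by simp
qed

lemma L2_inner_diff_left:
  assumes "f \<in> L2_space M" "g \<in> L2_space M" "u \<in> L2_space M"
  shows "L2_inner M (\<lambda>x. f x - g x) u = L2_inner M f u - L2_inner M g u"
  using L2_space_product_integrable[OF assms(1,3)] L2_space_product_integrable[OF assms(2,3)]
  by (simp add: L2_inner_def left_diff_distrib)

lemma L2_inner_sum_right:
  assumes "f \<in> L2_space M" "\<And>i. i \<in> F \<Longrightarrow> u i \<in> L2_space M"
  shows "L2_inner M f (\<lambda>x. \<Sum>i\<in>F. c i * u i x) = (\<Sum>i\<in>F. cnj (c i) * L2_inner M f (u i))"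
proof -
  have int: "integrable M (\<lambda>x. f x * cnj (u i x))" if "i \<in> F" for i
    by (rule L2_space_product_integrable) (use assms that in auto)
  have "L2_inner M f (\<lambda>x. \<Sum>i\<in>F. c i * u i x)
      = (LINT x|M. (\<Sum>i\<in>F. cnj (c i) * (f x * cnj (u i x))))"
    unfolding L2_inner_def
    by (simp add: cnj_sum sum_distrib_left mult.left_commute mult.assoc)
  also have "\<dots> = (\<Sum>i\<in>F. (LINT x|M. cnj (c i) * (f x * cnj (u i x))))"
    by (rule Bochner_Integration.integral_sum) (use int in auto)
  also have "\<dots> = (\<Sum>i\<in>F. cnj (c i) * L2_inner M f (u i))"
    by (simp add: L2_inner_def)
  finally show ?thesis .
qed

text \<open>
  By Pythagoras the square of the right-hand side exceeds that of the left-hand side by the squared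
  norm of \<open>g\<close>.
\<close>

lemma L2_norm_le_diff_orthogonal:
  assumes "f \<in> L2_space M" "g \<in> L2_space M" and orth: "L2_inner M f g = 0"
  shows "L2_norm M f \<le> L2_norm M (\<lambda>x. f x - g x)"
proof -
  have int: "integrable M (\<lambda>x. f x * cnj (g x))"
    by (rule L2_space_product_integrable[OF assms(1,2)])
  have sq: "(cmod (f x - g x))\<^sup>2 = (cmod (f x))\<^sup>2 + (cmod (g x))\<^sup>2 - 2 * Re (f x * cnj (g x))" for x
    by (simp only: cmod_power2) (simp add: power2_eq_square algebra_simps)
  have "(L2_norm M (\<lambda>x. f x - g x))\<^sup>2
      = (LINT x|M. (cmod (f x))\<^sup>2 + (cmod (g x))\<^sup>2 - 2 * Re (f x * cnj (g x)))"
    by (simp only: L2_norm_square sq)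
  also have "\<dots> = (L2_norm M f)\<^sup>2 + (L2_norm M g)\<^sup>2 - 2 * Re (L2_inner M f g)"
    using int integrable_Re[OF int] integral_Re[OF int] assms
    by (simp add: L2_norm_square L2_inner_def L2_space_square_integrable del: times_complex.sel)
  finally have "(L2_norm M f)\<^sup>2 \<le> (L2_norm M (\<lambda>x. f x - g x))\<^sup>2"
    using orth by simp
  then show ?thesis
    by (rule power2_le_imp_le) (simp add: L2_norm_def)
qed

section \<open>Total families\<close>

text \<open>
  The only consequence of the basis or frame property that matters for essential injectivity
  is the triviality of the orthogonal complement.
\<close>

definition L2_total :: "'a measure \<Rightarrow> 'i set \<Rightarrow> ('i \<Rightarrow> 'a \<Rightarrow> complex) \<Rightarrow> bool" where
  "L2_total M I u \<longleftrightarrow> (\<forall>i\<in>I. u i \<in> L2_space M) \<and>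
     (\<forall>f\<in>L2_space M. (\<forall>i\<in>I. L2_inner M f (u i) = 0) \<longrightarrow> (AE x in M. f x = 0))"

text \<open>
  A vector orthogonal to the span is no longer than its distance to any point of the span,
  and density makes that distance arbitrarily small.
\<close>

lemma L2_orthogonal_basis_imp_total:
  assumes "L2_orthogonal_basis M I u"
  shows "L2_total M I u"
proof -
  have u: "u i \<in> L2_space M" if "i \<in> I" for i
    using assms that by (simp add: L2_orthogonal_basis_def)
  have "AE x in M. f x = 0"
    if f: "f \<in> L2_space M" and orth: "\<forall>i\<in>I. L2_inner M f (u i) = 0" for f
  proof -
    have "L2_norm M f \<le> \<epsilon>" if "\<epsilon> > 0" for \<epsilon>
    proof -
      obtain F c where F: "finite F" "F \<subseteq> I"
        and le: "L2_norm M (\<lambda>x. f x - (\<Sum>i\<in>F. c i * u i x)) < \<epsilon>"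
        using assms f \<open>\<epsilon> > 0\<close> unfolding L2_orthogonal_basis_def by meson
      have "L2_inner M f (\<lambda>x. \<Sum>i\<in>F. c i * u i x) = (\<Sum>i\<in>F. cnj (c i) * L2_inner M f (u i))"
        by (rule L2_inner_sum_right) (use f u F in auto)
      also have "\<dots> = 0"
        using orth F by (intro sum.neutral) auto
      finally have "L2_norm M f \<le> L2_norm M (\<lambda>x. f x - (\<Sum>i\<in>F. c i * u i x))"
        by (intro L2_norm_le_diff_orthogonal f L2_space_sum L2_space_cmult)
          (use u F in auto)
      then show ?thesis using le by simp
    qed
    then have "L2_norm M f \<le> 0"
      by (rule field_le_epsilon[of _ 0, simplified])
    then have "L2_norm M f = 0"
      by (simp add: L2_norm_def order_antisym)
    then show ?thesis
      using L2_norm_eq_0_iff[OF f] by simp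
  qed
  then show ?thesis using u by (simp add: L2_total_def)
qed

text \<open>The lower frame bound controls the norm of a vector by its frame coefficients.\<close>

lemma L2_frame_imp_total:
  assumes "L2_frame M I u"
  shows "L2_total M I u"
proof -
  obtain A :: real where "0 < A" and A: "\<And>f. f \<in> L2_space M \<Longrightarrow>
      A * (L2_norm M f)\<^sup>2 \<le> (\<Sum>\<^sub>\<infinity>i\<in>I. (cmod (L2_inner M f (u i)))\<^sup>2)"
    using assms unfolding L2_frame_def by blast
  have "AE x in M. f x = 0"
    if f: "f \<in> L2_space M" and orth: "\<forall>i\<in>I. L2_inner M f (u i) = 0" for f
  proof -
    have "(\<Sum>\<^sub>\<infinity>i\<in>I. (cmod (L2_inner M f (u i)))\<^sup>2) = 0"
      using orth by (intro infsum_0) auto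
    then have "(L2_norm M f)\<^sup>2 \<le> 0"
      using A[OF f] \<open>0 < A\<close> by (simp add: mult_le_0_iff)
    then show ?thesis
      using L2_norm_eq_0_iff[OF f] by simp
  qed
  then show ?thesis using assms by (simp add: L2_total_def L2_frame_def)
qed

section \<open>Pulling back along a measurable map\<close>

text \<open>
  The functions \<open>u i\<close> are the pullbacks of \<open>e i\<close> only up to null sets, because a map given on
  a conull set has to be extended to the whole space before its pushforward is a \<open>distr\<close>.
\<close>

locale pullback_family =
  fixes M :: "'a measure" and N :: "'b measure" and T :: "'a \<Rightarrow> 'b"
    and I :: "'i set" and u :: "'i \<Rightarrow> 'a \<Rightarrow> complex" and e :: "'i \<Rightarrow> 'b \<Rightarrow> complex"
  assumes T [measurable]: "T \<in> M \<rightarrow>\<^sub>M N"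
    and distr_eq: "distr M N T = N"
    and e_measurable [measurable]: "\<And>i. e i \<in> borel_measurable N"
    and u_measurable [measurable]: "\<And>i. u i \<in> borel_measurable M"
    and u_eq: "\<And>i. AE x in M. u i x = e i (T x)"
begin

lemma integral_pullback:
  fixes g :: "'b \<Rightarrow> 'c::{banach, second_countable_topology}"
  assumes [measurable]: "g \<in> borel_measurable N" "f \<in> borel_measurable M"
    and "AE x in M. f x = g (T x)"
  shows "(LINT x|M. f x) = (LINT y|N. g y)" "integrable M f \<longleftrightarrow> integrable N g"
proof -
  have "(LINT x|M. f x) = (LINT x|M. g (T x))"
    using assms by (intro integral_cong_AE) auto
  also have "\<dots> = (LINT y|distr M N T. g y)"
    by (rule integral_distr[symmetric]) auto
  finally show "(LINT x|M. f x) = (LINT y|N. g y)" by (simp add: distr_eq)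
  have "integrable M f \<longleftrightarrow> integrable M (\<lambda>x. g (T x))"
    using assms by (intro integrable_cong_AE) auto
  also have "\<dots> \<longleftrightarrow> integrable (distr M N T) g"
    by (rule integrable_distr_eq[symmetric]) auto
  finally show "integrable M f \<longleftrightarrow> integrable N g" by (simp add: distr_eq)
qed

lemma L2_space_pullback:
  assumes [measurable]: "h \<in> borel_measurable N" "f \<in> borel_measurable M"
    and eq: "AE x in M. f x = h (T x)"
  shows "f \<in> L2_space M \<longleftrightarrow> h \<in> L2_space N"
proof -
  have "integrable M (\<lambda>x. (cmod (f x))\<^sup>2) \<longleftrightarrow> integrable N (\<lambda>y. (cmod (h y))\<^sup>2)"
    by (rule integral_pullback(2)) (use eq in auto)
  then show ?thesis by (simp add: L2_space_def)
qed

lemma L2_norm_pullback: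
  assumes [measurable]: "h \<in> borel_measurable N" "f \<in> borel_measurable M"
    and eq: "AE x in M. f x = h (T x)"
  shows "L2_norm M f = L2_norm N h"
proof -
  have "(LINT x|M. (cmod (f x))\<^sup>2) = (LINT y|N. (cmod (h y))\<^sup>2)"
    by (rule integral_pullback(1)) (use eq in auto)
  then show ?thesis by (simp add: L2_norm_def)
qed

lemma L2_inner_pullback:
  assumes [measurable]: "h \<in> borel_measurable N" "f \<in> borel_measurable M"
    "k \<in> borel_measurable N" "g \<in> borel_measurable M"
    and eq: "AE x in M. f x = h (T x)" "AE x in M. g x = k (T x)"
  shows "L2_inner M f g = L2_inner N h k"
  unfolding L2_inner_def by (rule integral_pullback(1)) (use eq in auto)

lemma u_in_L2_iff: "u i \<in> L2_space M \<longleftrightarrow> e i \<in> L2_space N"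
  by (rule L2_space_pullback) (use u_eq in auto)

lemma L2_inner_u_u: "L2_inner M (u i) (u j) = L2_inner N (e i) (e j)"
  by (rule L2_inner_pullback) (use u_eq in auto)

lemma L2_inner_u:
  assumes [measurable]: "h \<in> borel_measurable N" "f \<in> borel_measurable M"
    and eq: "AE x in M. f x = h (T x)"
  shows "L2_inner M f (u i) = L2_inner N h (e i)"
  by (rule L2_inner_pullback) (use u_eq eq in auto)

lemma L2_norm_diff_sum_u:
  assumes [measurable]: "h \<in> borel_measurable N" "f \<in> borel_measurable M"
    and eq: "AE x in M. f x = h (T x)" and "finite F"
  shows "L2_norm M (\<lambda>x. f x - (\<Sum>i\<in>F. c i * u i x)) = L2_norm N (\<lambda>y. h y - (\<Sum>i\<in>F. c i * e i y))"
proof (rule L2_norm_pullback)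
  have "AE x in M. \<forall>i\<in>F. u i x = e i (T x)"
    using \<open>finite F\<close> u_eq by (intro AE_finite_allI) auto
  then show "AE x in M. f x - (\<Sum>i\<in>F. c i * u i x) = h (T x) - (\<Sum>i\<in>F. c i * e i (T x))"
    using eq by eventually_elim simp
qed measurable

lemma pullback_in_L2: "h \<in> L2_space N \<Longrightarrow> (\<lambda>x. h (T x)) \<in> L2_space M"
  using L2_space_pullback[of h "\<lambda>x. h (T x)"] L2_space_measurable[of h N] by auto

text \<open>
  Properties of the \<open>u i\<close> in the larger space descend without surjectivity: it suffices to apply
  them to the functions \<open>h \<circ> T\<close>.
\<close>

lemma orthogonal_basis_of_pullback:
  assumes "L2_orthogonal_basis M I u"
  shows "L2_orthogonal_basis N I e"
  unfolding L2_orthogonal_basis_def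
proof (intro conjI ballI allI impI)
  fix i assume "i \<in> I"
  then show "e i \<in> L2_space N"
    using assms u_in_L2_iff by (simp add: L2_orthogonal_basis_def)
  show "L2_norm N (e i) \<noteq> 0"
    using \<open>i \<in> I\<close> assms L2_norm_pullback[OF e_measurable u_measurable u_eq]
    by (simp add: L2_orthogonal_basis_def)
next
  fix i j assume "i \<in> I" "j \<in> I" "i \<noteq> j"
  then show "L2_inner N (e i) (e j) = 0"
    using assms by (simp add: L2_orthogonal_basis_def L2_inner_u_u)
next
  fix h and \<epsilon> :: real assume h: "h \<in> L2_space N" and "\<epsilon> > 0"
  note [measurable] = L2_space_measurable[OF h]
  obtain F c where F: "finite F" "F \<subseteq> I"
    and le: "L2_norm M (\<lambda>x. h (T x) - (\<Sum>i\<in>F. c i * u i x)) < \<epsilon>"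
    using assms pullback_in_L2[OF h] \<open>\<epsilon> > 0\<close> unfolding L2_orthogonal_basis_def by meson
  have "L2_norm N (\<lambda>y. h y - (\<Sum>i\<in>F. c i * e i y)) < \<epsilon>"
    using le L2_norm_diff_sum_u[of h "\<lambda>x. h (T x)" F c] F by simp
  then show "\<exists>F c. finite F \<and> F \<subseteq> I \<and> L2_norm N (\<lambda>y. h y - (\<Sum>i\<in>F. c i * e i y)) < \<epsilon>"
    using F by blast
qed

text \<open>
  In the other direction density has to be checked for every function on \<open>M\<close>, so each of them must
  factor through \<open>T\<close>.
\<close>

lemma orthogonal_basis_pullback:
  assumes "L2_orthogonal_basis N I e"
    and onto: "\<And>f. f \<in> L2_space M \<Longrightarrow> \<exists>h\<in>L2_space N. AE x in M. f x = h (T x)"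
  shows "L2_orthogonal_basis M I u"
  unfolding L2_orthogonal_basis_def
proof (intro conjI ballI allI impI)
  fix i assume "i \<in> I"
  then show "u i \<in> L2_space M"
    using assms u_in_L2_iff by (simp add: L2_orthogonal_basis_def)
  show "L2_norm M (u i) \<noteq> 0"
    using \<open>i \<in> I\<close> assms L2_norm_pullback[OF e_measurable u_measurable u_eq]
    by (simp add: L2_orthogonal_basis_def)
next
  fix i j assume "i \<in> I" "j \<in> I" "i \<noteq> j"
  then show "L2_inner M (u i) (u j) = 0"
    using assms by (simp add: L2_orthogonal_basis_def L2_inner_u_u)
next
  fix f and \<epsilon> :: real assume f: "f \<in> L2_space M" and "\<epsilon> > 0"
  obtain h where h: "h \<in> L2_space N" and eq: "AE x in M. f x = h (T x)"
    using onto[OF f] by blast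
  obtain F c where F: "finite F" "F \<subseteq> I"
    and le: "L2_norm N (\<lambda>y. h y - (\<Sum>i\<in>F. c i * e i y)) < \<epsilon>"
    using assms(1) h \<open>\<epsilon> > 0\<close> unfolding L2_orthogonal_basis_def by meson
  have "L2_norm M (\<lambda>x. f x - (\<Sum>i\<in>F. c i * u i x)) < \<epsilon>"
    using le L2_norm_diff_sum_u[OF L2_space_measurable[OF h] L2_space_measurable[OF f] eq F(1)]
    by simp
  then show "\<exists>F c. finite F \<and> F \<subseteq> I \<and> L2_norm M (\<lambda>x. f x - (\<Sum>i\<in>F. c i * u i x)) < \<epsilon>"
    using F by blast
qed

lemma frame_of_pullback:
  assumes "L2_frame M I u"
  shows "L2_frame N I e"
proof -
  obtain A B :: real where AB: "0 < A" "A \<le> B"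
    and frame: "\<And>f. f \<in> L2_space M \<Longrightarrow>
           (\<lambda>i. (cmod (L2_inner M f (u i)))\<^sup>2) summable_on I \<and>
           A * (L2_norm M f)\<^sup>2 \<le> (\<Sum>\<^sub>\<infinity>i\<in>I. (cmod (L2_inner M f (u i)))\<^sup>2) \<and>
           (\<Sum>\<^sub>\<infinity>i\<in>I. (cmod (L2_inner M f (u i)))\<^sup>2) \<le> B * (L2_norm M f)\<^sup>2"
    using assms unfolding L2_frame_def by blast
  have "(\<lambda>i. (cmod (L2_inner N h (e i)))\<^sup>2) summable_on I \<and>
           A * (L2_norm N h)\<^sup>2 \<le> (\<Sum>\<^sub>\<infinity>i\<in>I. (cmod (L2_inner N h (e i)))\<^sup>2) \<and>
           (\<Sum>\<^sub>\<infinity>i\<in>I. (cmod (L2_inner N h (e i)))\<^sup>2) \<le> B * (L2_norm N h)\<^sup>2"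
    if h: "h \<in> L2_space N" for h
  proof -
    note [measurable] = L2_space_measurable[OF h]
    have "L2_norm M (\<lambda>x. h (T x)) = L2_norm N h"
      by (rule L2_norm_pullback) auto
    moreover have "L2_inner M (\<lambda>x. h (T x)) (u i) = L2_inner N h (e i)" for i
      by (rule L2_inner_u) auto
    ultimately show ?thesis
      using frame[OF pullback_in_L2[OF h]] by simp
  qed
  then show ?thesis
    using assms AB u_in_L2_iff unfolding L2_frame_def by blast
qed

lemma frame_pullback:
  assumes "L2_frame N I e"
    and onto: "\<And>f. f \<in> L2_space M \<Longrightarrow> \<exists>h\<in>L2_space N. AE x in M. f x = h (T x)"
  shows "L2_frame M I u"
proof -
  obtain A B :: real where AB: "0 < A" "A \<le> B"
    and frame: "\<And>h. h \<in> L2_space N \<Longrightarrow>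
           (\<lambda>i. (cmod (L2_inner N h (e i)))\<^sup>2) summable_on I \<and>
           A * (L2_norm N h)\<^sup>2 \<le> (\<Sum>\<^sub>\<infinity>i\<in>I. (cmod (L2_inner N h (e i)))\<^sup>2) \<and>
           (\<Sum>\<^sub>\<infinity>i\<in>I. (cmod (L2_inner N h (e i)))\<^sup>2) \<le> B * (L2_norm N h)\<^sup>2"
    using assms unfolding L2_frame_def by blast
  have "(\<lambda>i. (cmod (L2_inner M f (u i)))\<^sup>2) summable_on I \<and>
           A * (L2_norm M f)\<^sup>2 \<le> (\<Sum>\<^sub>\<infinity>i\<in>I. (cmod (L2_inner M f (u i)))\<^sup>2) \<and>
           (\<Sum>\<^sub>\<infinity>i\<in>I. (cmod (L2_inner M f (u i)))\<^sup>2) \<le> B * (L2_norm M f)\<^sup>2"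
    if f: "f \<in> L2_space M" for f
  proof -
    obtain h where h: "h \<in> L2_space N" and eq: "AE x in M. f x = h (T x)"
      using onto[OF f] by blast
    note hf = L2_space_measurable[OF h] L2_space_measurable[OF f] eq
    show ?thesis
      using frame[OF h] L2_norm_pullback[OF hf] L2_inner_u[OF hf] by simp
  qed
  then show ?thesis
    using assms AB u_in_L2_iff unfolding L2_frame_def by blast
qed

end

section \<open>Conditional expectations of bounded functions\<close>

text \<open>
  On the set where the Radon--Nikodym derivative \<open>D\<close> exceeds 1, domination forces the integral
  of \<open>D - 1\<close> over that set to vanish; hence \<open>D \<le> 1\<close> almost everywhere and \<open>D\<close> may be truncated at 1.
\<close>

lemma density_of_dominated_measure:
  assumes "finite_measure M" and sets: "sets N = sets M"
    and le: "\<And>A. A \<in> sets M \<Longrightarrow> emeasure N A \<le> emeasure M A"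
  obtains d :: "'a \<Rightarrow> real" where "d \<in> borel_measurable M"
    "\<And>x. 0 \<le> d x" "\<And>x. d x \<le> 1" "N = density M (\<lambda>x. ennreal (d x))"
proof -
  interpret finite_measure M by fact
  have "absolutely_continuous M N"
    unfolding absolutely_continuous_def
  proof (rule subsetI)
    fix A assume "A \<in> null_sets M"
    then show "A \<in> null_sets N"
      using le[of A] by (auto simp: null_sets_def sets)
  qed
  then obtain D where D [measurable]: "D \<in> borel_measurable M" and N: "density M D = N"
    using Radon_Nikodym[of N] sets by blast
  define A where "A = {x \<in> space M. 1 < D x}"
  have A [measurable]: "A \<in> sets M" unfolding A_def by measurable
  have "(\<integral>\<^sup>+x. (D x - 1) * indicator A x \<partial>M) + emeasure M A
      = (\<integral>\<^sup>+x. (D x - 1) * indicator A x + indicator A x \<partial>M)"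
    by (subst nn_integral_add) auto
  also have "\<dots> = (\<integral>\<^sup>+x. D x * indicator A x \<partial>M)"
    by (intro nn_integral_cong)
      (auto simp: A_def indicator_def diff_add_cancel_ennreal less_imp_le)
  also have "\<dots> = emeasure N A"
    by (simp add: N[symmetric] emeasure_density)
  also have "\<dots> \<le> 0 + emeasure M A"
    using le by simp
  finally have "(\<integral>\<^sup>+x. (D x - 1) * indicator A x \<partial>M) = 0"
    using emeasure_finite[of A] by (simp add: add.commute[of _ "emeasure M A"] ennreal_add_left_cancel_le)
  then have "AE x in M. (D x - 1) * indicator A x = 0"
    by (subst (asm) nn_integral_0_iff_AE) auto
  moreover have "AE x in M. x \<in> space M" by (rule AE_space)
  ultimately have D1: "AE x in M. D x \<le> 1"
  proof eventually_elim
    case (elim x)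
    then show ?case
      by (cases "x \<in> A") (auto simp: A_def not_less diff_eq_0_iff_ennreal)
  qed
  define d where "d x = min 1 (enn2real (D x))" for x
  have "AE x in M. D x = ennreal (d x)"
    using D1
  proof eventually_elim
    case (elim x)
    then have "enn2real (D x) \<le> 1" by (simp add: enn2real_leI)
    moreover have "D x < top" using elim by (simp add: le_less_trans[of _ 1])
    ultimately show ?case by (simp add: d_def)
  qed
  then have "density M D = density M (\<lambda>x. ennreal (d x))"
    by (intro density_cong) (auto simp: d_def)
  then show ?thesis
    using N by (intro that[of d]) (auto simp: d_def[abs_def])
qed

text \<open>
  The density \<open>d\<close> of the pushforward of \<open>f \<cdot> M\<close> with respect to \<open>N\<close> is the conditional expectation
  of \<open>f\<close> given \<open>T\<close>, as a function on the target of \<open>T\<close>. The difference \<open>f - d \<circ> T\<close> is orthogonal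
  to every function of \<open>T\<close>, in particular to every \<open>u i\<close>, so totality makes it vanish.
\<close>

lemma (in pullback_family) total_imp_bounded_factors:
  fixes f :: "'a \<Rightarrow> real"
  assumes total: "L2_total M I u" and fin: "finite_measure M"
    and f [measurable]: "f \<in> borel_measurable M" and f01: "\<And>x. 0 \<le> f x" "\<And>x. f x \<le> 1"
  obtains d where "d \<in> borel_measurable N" "AE x in M. f x = d (T x)"
proof -
  interpret M: finite_measure M by fact
  have finN: "finite_measure N"
    using M.finite_measure_distr[OF T] by (simp add: distr_eq)
  let ?P = "distr (density M (\<lambda>x. ennreal (f x))) N T"
  have dom: "emeasure ?P A \<le> emeasure N A" if A [measurable]: "A \<in> sets N" for A
  proof -
    have "emeasure ?P A = (\<integral>\<^sup>+x. ennreal (f x) * indicator (T -` A \<inter> space M) x \<partial>M)"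
      by (simp add: emeasure_distr emeasure_density)
    also have "\<dots> \<le> (\<integral>\<^sup>+x. indicator (T -` A \<inter> space M) x \<partial>M)"
      using f01 by (intro nn_integral_mono) (auto simp: indicator_def)
    also have "\<dots> = emeasure (distr M N T) A"
      by (simp add: emeasure_distr)
    finally show ?thesis by (simp add: distr_eq)
  qed
  obtain d where d [measurable]: "d \<in> borel_measurable N"
    and d01: "\<And>y. 0 \<le> d y" "\<And>y. d y \<le> 1" and P: "?P = density N (\<lambda>y. ennreal (d y))"
    using density_of_dominated_measure[OF finN, of ?P] dom by auto
  let ?f = "\<lambda>x. complex_of_real (f x)" and ?g = "\<lambda>x. complex_of_real (d (T x))"
  have fL2: "?f \<in> L2_space M" and gL2: "?g \<in> L2_space M"
    using f01 d01 by (auto intro!: L2_space_bounded[OF fin, of _ 1])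
  have "L2_inner M (\<lambda>x. ?f x - ?g x) (u i) = 0" if "i \<in> I" for i
  proof -
    have "L2_inner M ?f (u i) = (LINT x|M. f x *\<^sub>R cnj (e i (T x)))"
      unfolding L2_inner_def
    proof (rule integral_cong_AE)
      show "AE x in M. ?f x * cnj (u i x) = f x *\<^sub>R cnj (e i (T x))"
        using u_eq[of i] by eventually_elim (simp add: scaleR_conv_of_real)
    qed measurable
    also have "\<dots> = (LINT x|density M (\<lambda>x. ennreal (f x)). cnj (e i (T x)))"
      using f01 by (intro integral_density[symmetric]) auto
    also have "\<dots> = (LINT y|?P. cnj (e i y))"
      by (intro integral_distr[symmetric]) auto
    also have "\<dots> = (LINT y|N. d y *\<^sub>R cnj (e i y))"
      unfolding P using d01 by (intro integral_density) auto
    also have "\<dots> = L2_inner N (\<lambda>y. complex_of_real (d y)) (e i)"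
      by (simp add: L2_inner_def scaleR_conv_of_real)
    also have "\<dots> = L2_inner M ?g (u i)"
      by (rule L2_inner_u[symmetric]) auto
    finally show ?thesis
      using L2_inner_diff_left[OF fL2 gL2] total that by (simp add: L2_total_def)
  qed
  then have "AE x in M. ?f x - ?g x = 0"
    using total L2_space_diff[OF fL2 gL2] unfolding L2_total_def by blast
  then have "AE x in M. f x = d (T x)"
    by eventually_elim simp
  then show ?thesis using that d by blast
qed

section \<open>Totality forces essential injectivity\<close>

text \<open>
  Squashing each coordinate into the unit interval by the arctangent makes it bounded, hence a
  function of \<open>T\<close>. Undoing the squashing and reassembling the coordinates recovers the point.
\<close>

lemma total_imp_left_inverse:
  fixes M :: "'a::euclidean_space measure"
  assumes "pullback_family M N T u e" and "L2_total M I u"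
    and "finite_measure M" and sets: "sets M = sets borel"
  obtains H where "H \<in> N \<rightarrow>\<^sub>M M" "AE x in M. H (T x) = x"
proof -
  interpret pullback_family M N T I u e by fact
  have [measurable]: "(\<lambda>x. x \<bullet> b) \<in> borel_measurable M" for b :: 'a
    by (subst measurable_cong_sets[OF sets refl]) measurable
  have "\<exists>d. d \<in> borel_measurable N \<and> (AE x in M. arctan (x \<bullet> b) / pi + 1/2 = d (T x))" for b
  proof -
    have arctan01: "0 \<le> arctan t / pi + 1/2" "arctan t / pi + 1/2 \<le> 1" for t
      using arctan_bounded[of t] by (simp_all add: field_simps)
    show ?thesis
      by (rule total_imp_bounded_factors[of "\<lambda>x. arctan (x \<bullet> b) / pi + 1/2", OF assms(2,3)])
        (auto intro: arctan01 simp del: One_nat_def)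
  qed
  then obtain d where d [measurable]: "\<And>b. d b \<in> borel_measurable N"
    and eq: "\<And>b. AE x in M. arctan (x \<bullet> b) / pi + 1/2 = d b (T x)"
    by metis
  define H where "H y = (\<Sum>b\<in>Basis. tan (pi * (d b y - 1/2)) *\<^sub>R b)" for y
  have "H \<in> borel_measurable N"
    unfolding H_def tan_def by measurable
  then have "H \<in> N \<rightarrow>\<^sub>M M"
    by (subst measurable_cong_sets[OF refl sets])
  moreover have "AE x in M. \<forall>b\<in>Basis. arctan (x \<bullet> b) / pi + 1/2 = d b (T x)"
    using eq by (intro AE_finite_allI) auto
  then have "AE x in M. H (T x) = x"
  proof eventually_elim
    case (elim x)
    have "tan (pi * (d b (T x) - 1/2)) = x \<bullet> b" if "b \<in> Basis" for b
    proof -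
      have "d b (T x) = arctan (x \<bullet> b) / pi + 1/2"
        using elim that by simp
      then have "pi * (d b (T x) - 1/2) = arctan (x \<bullet> b)"
        by simp
      then show ?thesis by (simp add: tan_arctan)
    qed
    then show ?case by (simp add: H_def euclidean_representation)
  qed
  ultimately show ?thesis using that by blast
qed

lemma total_imp_onto:
  fixes M :: "'a::euclidean_space measure"
  assumes "pullback_family M N T u e" and "L2_total M I u"
    and "finite_measure M" and "sets M = sets borel" and f: "f \<in> L2_space M"
  shows "\<exists>h\<in>L2_space N. AE x in M. f x = h (T x)"
proof -
  interpret pullback_family M N T I u e by fact
  obtain H where H [measurable]: "H \<in> N \<rightarrow>\<^sub>M M" and inv: "AE x in M. H (T x) = x"
    using total_imp_left_inverse[OF assms(1-4)] by blast
  note [measurable] = L2_space_measurable[OF f]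
  have eq: "AE x in M. f x = f (H (T x))"
    using inv by eventually_elim simp
  moreover have "(\<lambda>y. f (H y)) \<in> L2_space N"
    using L2_space_pullback[of "\<lambda>y. f (H y)" f] eq f by simp
  ultimately show ?thesis by (intro bexI[of _ "\<lambda>y. f (H y)"])
qed

section \<open>Discreteness of orthogonal spectra\<close>

lemma continuous_on_expo: "continuous_on A (expo \<xi>)"
  unfolding expo_def by (intro continuous_intros)

lemma expo_measurable [measurable]: "expo \<xi> \<in> borel_measurable borel"
  by (intro borel_measurable_continuous_onI continuous_on_expo)

lemma cmod_expo [simp]: "cmod (expo \<xi> x) = 1"
  by (simp add: expo_def norm_exp_eq_Re)

text \<open>
  The inner product of two exponentials depends continuously on the frequencies, by dominated
  convergence, and on the diagonal it equals the total mass, which is nonzero. Near a frequency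
  it therefore stays away from 0, which excludes other frequencies of an orthogonal family.
\<close>

lemma orthogonal_expo_imp_discrete:
  fixes \<nu> :: "'a::euclidean_space measure"
  assumes fin: "finite_measure \<nu>" and sets: "sets \<nu> = sets borel"
    and nz: "\<And>\<xi>. \<xi> \<in> \<Lambda> \<Longrightarrow> L2_norm \<nu> (expo \<xi>) \<noteq> 0"
    and orth: "\<And>\<xi> \<eta>. \<xi> \<in> \<Lambda> \<Longrightarrow> \<eta> \<in> \<Lambda> \<Longrightarrow> \<xi> \<noteq> \<eta> \<Longrightarrow> L2_inner \<nu> (expo \<xi>) (expo \<eta>) = 0"
  shows "discrete \<Lambda>"
proof (rule discreteI)
  interpret finite_measure \<nu> by fact
  fix \<xi> assume \<xi>: "\<xi> \<in> \<Lambda>"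
  have [measurable]: "expo \<eta> \<in> borel_measurable \<nu>" for \<eta>
    by (subst measurable_cong_sets[OF sets refl]) measurable
  have "\<not> \<xi> islimpt \<Lambda>"
  proof
    assume "\<xi> islimpt \<Lambda>"
    then obtain s where s: "\<And>n. s n \<in> \<Lambda> - {\<xi>}" "s \<longlonglongrightarrow> \<xi>"
      unfolding islimpt_sequential by blast
    have "(\<lambda>n. L2_inner \<nu> (expo \<xi>) (expo (s n))) \<longlonglongrightarrow> L2_inner \<nu> (expo \<xi>) (expo \<xi>)"
      unfolding L2_inner_def
    proof (rule integral_dominated_convergence[where w = "\<lambda>_. 1"])
      show "AE x in \<nu>. (\<lambda>n. expo \<xi> x * cnj (expo (s n) x)) \<longlonglongrightarrow> expo \<xi> x * cnj (expo \<xi> x)"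
        unfolding expo_def by (intro AE_I2 tendsto_intros s(2))
    qed (auto simp: norm_mult)
    moreover have "L2_inner \<nu> (expo \<xi>) (expo (s n)) = 0" for n
      using s(1)[of n] \<xi> by (intro orth) auto
    ultimately have "L2_inner \<nu> (expo \<xi>) (expo \<xi>) = 0"
      by (simp add: LIMSEQ_const_iff)
    moreover have "expo \<xi> x * cnj (expo \<xi> x) = 1" for x
      by (simp add: complex_norm_square[symmetric])
    ultimately have "measure \<nu> (space \<nu>) = 0"
      by (simp add: L2_inner_def)
    then have "L2_norm \<nu> (expo \<xi>) = 0"
      by (simp add: L2_norm_def)
    with nz[OF \<xi>] show False by simp
  qed
  with \<xi> show "\<xi> isolated_in \<Lambda>"
    by (simp add: isolated_in_islimpt_iff)
qed

section \<open>Maps on the closed support\<close>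

text \<open>
  The complement of the closed support is a null set, so extending \<open>\<phi>\<close> by a constant changes neither
  the pushforward nor the pulled-back exponentials up to null sets.
\<close>

lemma pullback_family_pushforward:
  fixes \<mu> :: "'a::euclidean_space measure" and \<phi> :: "'a \<Rightarrow> 'b::euclidean_space"
  assumes sets: "sets \<mu> = sets borel"
    and \<phi>: "\<phi> \<in> borel_measurable (restrict_space borel (closed_support \<mu>))"
  defines "T \<equiv> (\<lambda>x. if x \<in> closed_support \<mu> then \<phi> x else 0)"
  shows "pullback_family \<mu> (pushforward \<mu> \<phi>) T (expo_comp \<mu> \<phi>) expo"
    and "AE x in \<mu>. T x = \<phi> x"
proof -
  let ?K = "closed_support \<mu>"
  have space: "space \<mu> = UNIV"
    using sets_eq_imp_space_eq[OF sets] by simp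
  have K [measurable]: "?K \<in> sets \<mu>"
    by (simp add: sets borel_closed closed_closed_support)
  have AE_K: "AE x in \<mu>. x \<in> ?K"
    using emeasure_compl_closed_support[OF sets]
    by (intro AE_I[of _ _ "- ?K"]) (auto simp: sets closed_closed_support borel_comp)
  show T_eq: "AE x in \<mu>. T x = \<phi> x"
    using AE_K by eventually_elim (simp add: T_def)
  have "\<phi> \<in> borel_measurable (restrict_space \<mu> ?K)"
    using \<phi> measurable_cong_sets[OF sets_restrict_space_cong[OF sets] refl] by blast
  then have T: "T \<in> borel_measurable \<mu>"
    unfolding T_def by (subst (asm) measurable_restrict_space_iff[of _ _ 0]) auto
  have distr: "distr \<mu> borel T = pushforward \<mu> \<phi>"
  proof (rule measure_eqI)
    show "sets (distr \<mu> borel T) = sets (pushforward \<mu> \<phi>)"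
      by (simp add: pushforward_def)
    fix E assume "E \<in> sets (distr \<mu> borel T)"
    then have E [measurable]: "E \<in> sets borel" by simp
    note T [measurable]
    have [simp]: "{x \<in> ?K. \<phi> x \<in> E} = ?K \<inter> (T -` E \<inter> space \<mu>)"
      by (auto simp: T_def space)
    have "emeasure (distr \<mu> borel T) E = emeasure \<mu> (T -` E \<inter> space \<mu>)"
      by (simp add: emeasure_distr)
    also have "\<dots> = emeasure \<mu> {x \<in> ?K. \<phi> x \<in> E}"
      by (rule emeasure_eq_AE) (use AE_K in auto)
    finally show "emeasure (distr \<mu> borel T) E = emeasure (pushforward \<mu> \<phi>) E"
      using emeasure_pushforward[OF sets \<phi> E] by simp
  qed
  have [measurable_cong]: "sets (pushforward \<mu> \<phi>) = sets borel"
    by (simp add: pushforward_def)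
  show "pullback_family \<mu> (pushforward \<mu> \<phi>) T (expo_comp \<mu> \<phi>) expo"
  proof
    show "T \<in> \<mu> \<rightarrow>\<^sub>M pushforward \<mu> \<phi>"
      using T by (simp cong: measurable_cong_sets)
    show "distr \<mu> (pushforward \<mu> \<phi>) T = pushforward \<mu> \<phi>"
      using distr by (metis distr_cong sets_distr)
    note T [measurable]
    have "expo_comp \<mu> \<phi> \<xi> = (\<lambda>x. if x \<in> ?K then expo \<xi> (T x) else 0)" for \<xi>
      by (auto simp: expo_comp_def T_def)
    then show "expo_comp \<mu> \<phi> \<xi> \<in> borel_measurable \<mu>" for \<xi>
      by simp
    show "AE x in \<mu>. expo_comp \<mu> \<phi> \<xi> x = expo \<xi> (T x)" for \<xi>
      using AE_K by eventually_elim (simp add: expo_comp_def T_def)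
  qed measurable
qed

theorem theorem3p2:
  fixes \<mu> :: "(real ^ 'd) measure"
    and \<Lambda> :: "(real ^ 'd) set"
    and \<phi> :: "real ^ 'd \<Rightarrow> real ^ 'd"
  assumes "finite_borel_measure \<mu>"
    and "countable \<Lambda>"
    and "\<phi> \<in> borel_measurable (restrict_space borel (closed_support \<mu>))"
  shows "(L2_orthogonal_basis \<mu> \<Lambda> (expo_comp \<mu> \<phi>) \<longleftrightarrow>
            essentially_injective \<mu> \<phi> \<and> spectral_measure (pushforward \<mu> \<phi>) \<Lambda>) \<and>
         (L2_frame \<mu> \<Lambda> (expo_comp \<mu> \<phi>) \<longleftrightarrow>
            essentially_injective \<mu> \<phi> \<and> frame_spectral_measure (pushforward \<mu> \<phi>) \<Lambda>)"
proof -
  have fin: "finite_measure \<mu>" and sets: "sets \<mu> = sets borel"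
    using assms(1) by (auto simp: finite_borel_measure_def)
  interpret \<mu>: finite_measure \<mu> by (fact fin)
  let ?\<nu> = "pushforward \<mu> \<phi>" and ?u = "expo_comp \<mu> \<phi>"
  define T where "T = (\<lambda>x. if x \<in> closed_support \<mu> then \<phi> x else 0)"
  have family: "pullback_family \<mu> ?\<nu> T ?u expo" and T_eq: "AE x in \<mu>. T x = \<phi> x"
    unfolding T_def by (fact pullback_family_pushforward[OF sets assms(3)])+
  interpret pullback_family \<mu> ?\<nu> T \<Lambda> ?u expo by (fact family)
  have \<nu>_fin: "finite_measure ?\<nu>"
    using \<mu>.finite_measure_distr[OF T] by (simp add: distr_eq)
  have \<nu>_sets: "sets ?\<nu> = sets borel"
    by (simp add: pushforward_def)
  have "(AE x in \<mu>. f x = h (T x)) \<longleftrightarrow> (AE x in \<mu>. f x = h (\<phi> x))" for f h :: "_ \<Rightarrow> complex"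
    using T_eq by (intro eventually_subst) (auto elim!: eventually_mono)
  then have inj_iff: "essentially_injective \<mu> \<phi> \<longleftrightarrow>
      (\<forall>f\<in>L2_space \<mu>. \<exists>h\<in>L2_space ?\<nu>. AE x in \<mu>. f x = h (T x))"
    by (simp add: essentially_injective_def)
  have total_inj: "essentially_injective \<mu> \<phi>" if "L2_total \<mu> \<Lambda> ?u"
    using total_imp_onto[OF family that fin sets] by (simp add: inj_iff)
  have "L2_orthogonal_basis \<mu> \<Lambda> ?u \<longleftrightarrow> essentially_injective \<mu> \<phi> \<and> spectral_measure ?\<nu> \<Lambda>"
  proof (intro iffI conjI)
    assume basis: "L2_orthogonal_basis \<mu> \<Lambda> ?u"
    then show "essentially_injective \<mu> \<phi>"
      by (intro total_inj L2_orthogonal_basis_imp_total)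
    have basis': "L2_orthogonal_basis ?\<nu> \<Lambda> expo"
      by (rule orthogonal_basis_of_pullback[OF basis])
    moreover have "discrete \<Lambda>"
      by (rule orthogonal_expo_imp_discrete[OF \<nu>_fin \<nu>_sets])
        (use basis' in \<open>auto simp: L2_orthogonal_basis_def\<close>)
    ultimately show "spectral_measure ?\<nu> \<Lambda>"
      using \<nu>_fin \<nu>_sets assms(2) by (simp add: spectral_measure_def finite_borel_measure_def)
  next
    assume "essentially_injective \<mu> \<phi> \<and> spectral_measure ?\<nu> \<Lambda>"
    then show "L2_orthogonal_basis \<mu> \<Lambda> ?u"
      by (intro orthogonal_basis_pullback) (auto simp: inj_iff spectral_measure_def)
  qed
  moreover have "L2_frame \<mu> \<Lambda> ?u \<longleftrightarrow> essentially_injective \<mu> \<phi> \<and> frame_spectral_measure ?\<nu> \<Lambda>"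
  proof (intro iffI conjI)
    assume frame: "L2_frame \<mu> \<Lambda> ?u"
    then show "essentially_injective \<mu> \<phi>"
      by (intro total_inj L2_frame_imp_total)
    show "frame_spectral_measure ?\<nu> \<Lambda>"
      using frame_of_pullback[OF frame] \<nu>_fin \<nu>_sets
      by (simp add: frame_spectral_measure_def finite_borel_measure_def)
  next
    assume "essentially_injective \<mu> \<phi> \<and> frame_spectral_measure ?\<nu> \<Lambda>"
    then show "L2_frame \<mu> \<Lambda> ?u"
      by (intro frame_pullback) (auto simp: inj_iff frame_spectral_measure_def)
  qed
  ultimately show ?thesis by blast
qed

end
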